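(* 1. The one-sided exponential distribution $\nu_+$ satisfies $\mathrm{IC}(2)$. 2. The symmetric exponential distribution $\nu$ satisfies $\mathrm{IC}(2)$.
   Context: $\nu_+$ has density $e^{-x}\mathbb{I}_{[0,\infty)}(x)$ and $\nu$ has density $\frac12 e^{-|x|}$. A pair $(\mu,W)$, with $\mu$ a probability measure on $\mathbb{R}^n$ and $W:\mathbb{R}^n\to[0,\infty]$, satisfies property $(\tau)$ if for every bounded function $f$, $\int e^{h}\,d\mu\int e^{-f}\,d\mu\le 1$, where $h(x)=\inf_{y}\{W(x-y)+f(y)\}$ is the infimum convolution of $W$ and $f$. For a measure $\mu$, $\mu'$ is its reflection through the origin, $\overline{\mu}=\mu*\mu'$, $\Lambda_\mu=\ln\int e^{\langle \cdot,y\rangle}d\mu(y)$, and $\Lambda^*_\mu(x)=\sup_y\{\langle x,y\rangle-\Lambda_\mu(y)\}$. A probability measure $\mu$ satisfies $\mathrm{IC}(\beta)$ ($\beta>0$) if the pair $(\mu,\Lambda^*_{\overline{\mu}}(\cdot/\beta))$ satisfies property $(\tau)$. *)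

theory Defs
  imports "HOL-Probability.Probability"
begin

definition nu_plus :: "real measure" where
  "nu_plus = density lborel (\<lambda>x. ennreal (exp (- x) * indicator {0..} x))"

definition nu_sym :: "real measure" where
  "nu_sym = density lborel (\<lambda>x. ennreal (exp (- \<bar>x\<bar>) / 2))"

definition eexp :: "ereal \<Rightarrow> ennreal" where
  "eexp t = (case t of ereal r \<Rightarrow> ennreal (exp r) | PInfty \<Rightarrow> \<infinity> | MInfty \<Rightarrow> 0)"

definition inf_conv :: "(real \<Rightarrow> ereal) \<Rightarrow> (real \<Rightarrow> real) \<Rightarrow> real \<Rightarrow> ereal" where
  "inf_conv W f x = (INF y. W (x - y) + ereal (f y))"

text \<open>Property (tau) for the pair (mu, W), W : R -> [0, inf].\<close>
definition property_tau :: "real measure \<Rightarrow> (real \<Rightarrow> ereal) \<Rightarrow> bool" where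
  "property_tau \<mu> W \<longleftrightarrow>
     (\<forall>f. f \<in> borel_measurable borel \<longrightarrow> bounded (range f) \<longrightarrow>
        (\<integral>\<^sup>+ x. eexp (inf_conv W f x) \<partial>\<mu>) * (\<integral>\<^sup>+ x. ennreal (exp (- f x)) \<partial>\<mu>) \<le> 1)"

definition reflect :: "real measure \<Rightarrow> real measure" where
  "reflect \<mu> = distr \<mu> borel uminus"

definition symmetrize :: "real measure \<Rightarrow> real measure" where
  "symmetrize \<mu> = convolution \<mu> (reflect \<mu>)"

definition log_laplace :: "real measure \<Rightarrow> real \<Rightarrow> ereal" where
  "log_laplace \<mu> y =
     (let I = (\<integral>\<^sup>+ x. ennreal (exp (x * y)) \<partial>\<mu>)
      in if I = \<infinity> then \<infinity> else ereal (ln (enn2real I)))"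

definition legendre :: "real measure \<Rightarrow> real \<Rightarrow> ereal" where
  "legendre \<mu> x = (SUP y. ereal (x * y) - log_laplace \<mu> y)"

definition IC :: "real \<Rightarrow> real measure \<Rightarrow> bool" where
  "IC \<beta> \<mu> \<longleftrightarrow> property_tau \<mu> (\<lambda>x. legendre (symmetrize \<mu>) (x / \<beta>))"

end

theory Submission
  imports Defs
begin

text \<open>For \<open>\<nu>\<^sub>+\<close> the cost is \<open>W x = k (x / 2)\<close> with \<open>k = \<Lambda>\<^sub>\<nu>\<^sup>*\<close>. If \<open>h x - g y \<le> W (x - y)\<close> and
  \<open>y = T x\<close> transports \<open>exp h d\<nu>\<^sub>+\<close> to \<open>exp (- g) d\<nu>\<^sub>+\<close>, both normalised, put \<open>z = (x + y) / 2\<close> and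
  \<open>u = (x - y) / 2\<close>. Then \<open>exp (k u - z)\<close> starts from \<open>1\<close> and decreases at least at the rate
  \<open>sqrt (a b)\<close> in the common mass parameter, where \<open>a\<close> and \<open>b\<close> are the two total masses, because
  \<open>exp (- k) \<le> 1 - k'\<^sup>2\<close>. Hence \<open>a b \<le> 1\<close>.

  For \<open>\<nu>\<close>, which is the law of the difference of two independent variables with law \<open>\<nu>\<^sub>+\<close>,
  tensorisation gives property (tau) with any cost \<open>v\<close> such that \<open>v (a + b) \<le> W a + W b\<close>. By
  convexity \<open>v x = 2 k (x / 4)\<close> qualifies, and this is exactly the cost in \<open>IC(2)\<close> for \<open>\<nu>\<close>, since
  symmetrising \<open>\<nu>\<close> doubles its log-Laplace transform.\<close>

subsection \<open>The cost function\<close>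

text \<open>The closed form of \<open>sup\<^sub>y (u y + ln (1 - y\<^sup>2))\<close> over \<open>\<bar>y\<bar> < 1\<close>, that is, of the Legendre
  transform for \<open>\<nu>\<^sub>+\<close> symmetrised; the maximiser is \<open>cost_slope u\<close>.\<close>
definition cost :: "real \<Rightarrow> real" where
  "cost u = sqrt (1 + u\<^sup>2) - 1 - ln ((1 + sqrt (1 + u\<^sup>2)) / 2)"

definition cost_slope :: "real \<Rightarrow> real" where
  "cost_slope u = u / (1 + sqrt (1 + u\<^sup>2))"

lemma one_le_sqrt: "1 \<le> sqrt (1 + u\<^sup>2)"
  by simp

lemma abs_cost_slope_less: "\<bar>cost_slope u\<bar> < 1"
proof -
  have "\<bar>u\<bar> < 1 + sqrt (1 + u\<^sup>2)"
    using real_sqrt_ge_abs2[of u 1] by simp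
  then show ?thesis
    unfolding cost_slope_def by simp
qed

lemma one_minus_cost_slope_sq: "1 - (cost_slope u)\<^sup>2 = 2 / (1 + sqrt (1 + u\<^sup>2))"
proof -
  define s where "s = sqrt (1 + u\<^sup>2)"
  have s: "1 + s \<noteq> 0"
    using one_le_sqrt[of u] unfolding s_def by linarith
  have "s\<^sup>2 = 1 + u\<^sup>2"
    by (simp add: s_def)
  then have "(1 + s)\<^sup>2 - u\<^sup>2 = 2 * (1 + s)"
    by (simp add: power2_eq_square algebra_simps)
  moreover have "1 - (cost_slope u)\<^sup>2 = ((1 + s)\<^sup>2 - u\<^sup>2) / (1 + s)\<^sup>2"
    unfolding cost_slope_def s_def[symmetric] using s by (simp add: power_divide diff_divide_distrib)
  ultimately show ?thesis
    using s by (simp add: s_def[symmetric]) (simp add: power2_eq_square divide_simps)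
qed

text \<open>The supremum is attained. With \<open>cost_ge\<close> this puts the tangent at
  \<open>u\<close> below the graph of \<open>cost\<close>, the source of the Lipschitz bound and of
  midpoint convexity.\<close>

lemma cost_eq_at_slope: "cost u = u * cost_slope u + ln (1 - (cost_slope u)\<^sup>2)"
proof -
  define s where "s = sqrt (1 + u\<^sup>2)"
  have s: "1 + s > 0"
    using one_le_sqrt[of u] unfolding s_def by linarith
  have "s\<^sup>2 = 1 + u\<^sup>2"
    by (simp add: s_def)
  then have "u * u = (s - 1) * (1 + s)"
    by (simp add: algebra_simps power2_eq_square)
  then have "u * cost_slope u = s - 1"
    unfolding cost_slope_def s_def[symmetric] times_divide_eq_right using s by simp
  then show ?thesis
    unfolding one_minus_cost_slope_sq cost_def s_def[symmetric]
    using ln_divide_pos[of 2 "1 + s"] ln_divide_pos[of "1 + s" 2] s by linarith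
qed

text \<open>\<open>ln t \<le> t - 1\<close> is used at
  \<open>t = (1 - y\<^sup>2) * (1 + s) / 2\<close>, which is \<open>1\<close> at the maximising
  \<open>y\<close>. What remains, multiplied by \<open>1 + s\<close>, is the square of
  \<open>u - y * (1 + s)\<close>, which vanishes there too.\<close>

lemma cost_ge:
  assumes "\<bar>y\<bar> < 1"
  shows "u * y + ln (1 - y\<^sup>2) \<le> cost u"
proof -
  define s where "s = sqrt (1 + u\<^sup>2)"
  have s: "s \<ge> 1" "s\<^sup>2 = 1 + u\<^sup>2"
    using one_le_sqrt[of u] by (auto simp: s_def)
  have y: "1 - y\<^sup>2 > 0"
    using assms by (simp add: abs_square_less_1)
  have "ln (1 - y\<^sup>2) + ln ((1 + s) / 2) = ln ((1 - y\<^sup>2) * ((1 + s) / 2))"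
    using y s by (intro ln_mult_pos[symmetric]) auto
  also have "\<dots> \<le> (1 - y\<^sup>2) * ((1 + s) / 2) - 1"
    using y s by (intro ln_le_minus_one) auto
  also have "\<dots> \<le> s - 1 - u * y"
  proof -
    have "0 \<le> (u - y * (1 + s))\<^sup>2"
      by simp
    also have "\<dots> = (1 + s) * ((s - 1) - 2 * u * y + y\<^sup>2 * (1 + s))"
      using s(2) by (simp add: power2_eq_square algebra_simps)
    finally have "0 \<le> (s - 1) - 2 * u * y + y\<^sup>2 * (1 + s)"
      using s by (simp add: zero_le_mult_iff)
    then show ?thesis
      by (simp add: field_simps)
  qed
  finally show ?thesis
    by (simp add: cost_def s_def)
qed

lemma cost_0 [simp]: "cost 0 = 0"
  by (simp add: cost_def)

lemma cost_nonneg: "0 \<le> cost u"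
  using cost_ge[of 0 u] by simp

lemma cost_minus [simp]: "cost (- u) = cost u"
  by (simp add: cost_def)

text \<open>The tangent at \<open>u\<close> is a minorant with slope below \<open>1\<close> in
  absolute value.\<close>

lemma cost_lipschitz: "cost u \<le> cost v + \<bar>u - v\<bar>"
proof -
  have "\<bar>(u - v) * cost_slope u\<bar> \<le> \<bar>u - v\<bar>"
    unfolding abs_mult using abs_cost_slope_less[of u] by (intro mult_left_le) auto
  then show ?thesis
    using cost_ge[OF abs_cost_slope_less, of v u] cost_eq_at_slope[of u]
    by (simp add: algebra_simps)
qed

text \<open>The tangent at the midpoint is tested at \<open>a\<close> and at \<open>b\<close>; the
  slope terms cancel in the sum.\<close>

lemma cost_midpoint: "2 * cost ((a + b) / 2) \<le> cost a + cost b"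
  using cost_ge[OF abs_cost_slope_less, of a "(a + b) / 2"]
    cost_ge[OF abs_cost_slope_less, of b "(a + b) / 2"]
    cost_eq_at_slope[of "(a + b) / 2"]
  by (simp add: field_simps)

section \<open>Differential inequalities and transport on the half-line\<close>

lemma DERIV_cost: "(cost has_real_derivative cost_slope u) (at u)"
proof -
  define s where "s = sqrt (1 + u\<^sup>2)"
  have s: "s \<ge> 1" "s\<^sup>2 = 1 + u\<^sup>2"
    using one_le_sqrt[of u] by (auto simp: s_def)
  have p: "0 < 1 + u\<^sup>2"
    by (simp add: add_pos_nonneg)
  have q: "0 < 1 + sqrt (1 + u\<^sup>2)"
    using one_le_sqrt[of u] by linarith
  have "(cost has_real_derivative u / s - u / s / (1 + s)) (at u)"
    unfolding cost_def [abs_def] s_def using p q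
    by (auto intro!: derivative_eq_intros simp: field_simps)
  moreover have "u / s - u / s / (1 + s) = cost_slope u"
    using s unfolding cost_slope_def s_def[symmetric] by (simp add: divide_simps) (simp add: algebra_simps)
  ultimately show ?thesis
    by simp
qed

text \<open>With \<open>v = (sqrt (1 + u\<^sup>2) - 1) / 2\<close> this is \<open>1 + v \<le> exp v\<close>, squared.\<close>
lemma exp_minus_cost_le: "exp (- cost u) \<le> 1 - (cost_slope u)\<^sup>2"
proof -
  define s where "s = sqrt (1 + u\<^sup>2)"
  have s: "s \<ge> 1"
    using one_le_sqrt[of u] by (auto simp: s_def)
  have "((1 + s) / 2)\<^sup>2 \<le> (exp ((s - 1) / 2))\<^sup>2"
    using exp_ge_add_one_self[of "(s - 1) / 2"] s
    by (intro power_mono) (auto simp: field_simps)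
  also have "\<dots> = exp (s - 1)"
    by (simp add: power2_eq_square flip: exp_add)
  finally have *: "((1 + s) / 2)\<^sup>2 \<le> exp (s - 1)" .
  have "exp (- cost u) = exp (ln ((1 + s) / 2)) / exp (s - 1)"
    by (simp add: cost_def s_def[symmetric] flip: exp_diff)
  also have "\<dots> = ((1 + s) / 2) / exp (s - 1)"
    using s by simp
  also have "\<dots> \<le> ((1 + s) / 2) / ((1 + s) / 2)\<^sup>2"
    using * s by (intro divide_left_mono) auto
  also have "\<dots> = 2 / (1 + s)"
    using s by (simp add: power2_eq_square divide_simps)
  finally show ?thesis
    by (simp add: one_minus_cost_slope_sq s_def)
qed

text \<open>With \<open>m = cost_slope u\<close>, the right side is the arithmetic mean of
  \<open>1 - m\<close> and \<open>p * (1 + m)\<close>. Their geometric mean is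
  \<open>sqrt (p * (1 - m\<^sup>2))\<close>, which \<open>exp_minus_cost_le\<close> compares with
  the left side. In the application \<open>p\<close> is the derivative of the transport map.\<close>

lemma sqrt_exp_cost_le:
  assumes "p > 0"
  shows "sqrt p * exp (- cost u / 2) \<le> (1 + p) / 2 - cost_slope u * (1 - p) / 2"
proof -
  define m where "m = cost_slope u"
  have m: "\<bar>m\<bar> < 1"
    using abs_cost_slope_less by (simp add: m_def)
  have "(sqrt p * exp (- cost u / 2))\<^sup>2 = p * exp (- cost u)"
    using assms by (simp add: power_mult_distrib flip: exp_double)
  also have "\<dots> \<le> p * (1 - m\<^sup>2)"
    using assms exp_minus_cost_le[of u] by (simp add: m_def)
  also have "\<dots> = ((1 + p) / 2 - m * (1 - p) / 2)\<^sup>2 - ((1 - p) / 2 - m * (1 + p) / 2)\<^sup>2"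
    by (simp add: power2_eq_square field_simps)
  also have "\<dots> \<le> ((1 + p) / 2 - m * (1 - p) / 2)\<^sup>2"
    by simp
  finally have "(sqrt p * exp (- cost u / 2))\<^sup>2 \<le> ((1 + p) / 2 - m * (1 - p) / 2)\<^sup>2" .
  moreover have "0 \<le> (1 + p) / 2 - m * (1 - p) / 2"
  proof -
    have "m * (1 - p) \<le> \<bar>m\<bar> * \<bar>1 - p\<bar>"
      by (metis abs_ge_self abs_mult)
    also have "\<dots> \<le> 1 * (1 + p)"
      using m assms by (intro mult_mono) auto
    finally show ?thesis
      by simp
  qed
  ultimately show ?thesis
    unfolding m_def by (rule power2_le_imp_le)
qed

text \<open>\<open>T\<close> transports the density \<open>exp (h x - x)\<close> on \<open>[0, x0]\<close> to a multiple of \<open>exp (- g y - y)\<close>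
  on \<open>[0, y0]\<close>, and \<open>\<Psi>\<close> is nonincreasing along it.\<close>
lemma transport_bound:
  fixes h g G F :: "real \<Rightarrow> real"
  assumes G: "\<And>x. (G has_real_derivative exp (h x - x)) (at x)" and G0: "G 0 = 0"
    and F: "\<And>y. (F has_real_derivative exp (- g y - y)) (at y)" and F0: "F 0 = 0"
    and hg: "\<And>x y. h x - g y \<le> cost ((x - y) / 2)"
    and x0: "x0 > 0" and y0: "y0 > 0"
  shows "G x0 * F y0 \<le> 1"
proof -
  have G_mono: "G a < G b" if "a < b" for a b
    using that by (rule DERIV_pos_imp_increasing) (use G in \<open>auto intro!: exI exp_gt_zero\<close>)
  have F_mono: "F a < F b" if "a < b" for a b
    using that by (rule DERIV_pos_imp_increasing) (use F in \<open>auto intro!: exI exp_gt_zero\<close>)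
  have "inj F"
    using F_mono by (intro linorder_injI) (metis less_irrefl)
  define S where "S = inv F"
  have SF [simp]: "S (F y) = y" for y
    by (simp add: S_def \<open>inj F\<close>)
  have Fcont: "isCont F y" for y
    using F DERIV_isCont by blast
  \<comment> \<open>\<open>S\<close> inverts \<open>F\<close> only on the range of \<open>F\<close>.
    The margins \<open>-1\<close> and \<open>y0 + 1\<close> put \<open>[0, F y0]\<close> strictly
    inside \<open>(a, b)\<close>, so \<open>S\<close> is differentiable from both sides at the
    endpoints as well.\<close>
  define a b where "a = F (-1)" and "b = F (y0 + 1)"
  have FS: "F (S v) = v" if "a \<le> v" "v \<le> b" for v
  proof -
    have "\<exists>y \<ge> -1. y \<le> y0 + 1 \<and> F y = v"
      using that y0 Fcont by (intro IVT) (auto simp: a_def b_def)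
    then obtain y where "F y = v"
      by blast
    then show ?thesis
      using SF by metis
  qed
  have S_deriv: "(S has_real_derivative exp (g (S v) + S v)) (at v)" if v: "a < v" "v < b" for v
  proof -
    have "isCont S (F (S v))"
      by (rule isCont_inverse_function[of 1]) (auto intro: Fcont)
    then have "isCont S v"
      using FS v by simp
    then have "(S has_real_derivative inverse (exp (- g (S v) - S v))) (at v)"
      using F v FS by (intro DERIV_inverse_function[of F]) auto
    then show ?thesis
      by (simp add: add.commute flip: exp_minus)
  qed
  \<comment> \<open>This ratio equalises the masses, so \<open>T\<close> runs from \<open>0\<close>
    to \<open>y0\<close>. It also makes \<open>sqrt c * G x0\<close> the square root of
    \<open>G x0 * F y0\<close>.\<close>
  define c where "c = F y0 / G x0"
  have Gpos: "G x0 > 0" and Fpos: "F y0 > 0"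
    using G_mono[OF x0] F_mono[OF y0] G0 F0 by auto
  have c: "c > 0"
    using Gpos Fpos by (simp add: c_def)
  define T where "T x = S (c * G x)" for x
  define p where "p x = c * exp (h x - x) * exp (g (T x) + T x)" for x
  \<comment> \<open>The first summand is \<open>1\<close> at \<open>0\<close> and always positive,
    so monotonicity bounds the second one by \<open>1\<close> at \<open>x0\<close>.\<close>
  define \<Psi> where "\<Psi> x = exp (cost ((x - T x) / 2) - (x + T x) / 2) + sqrt c * G x" for x
  have T_deriv: "(T has_real_derivative p x) (at x)" if x: "0 \<le> x" "x \<le> x0" for x
  proof -
    have "0 \<le> G x" "G x \<le> G x0"
      using G_mono[of 0 x] G_mono[of x x0] x G0 by (auto simp: order_le_less)
    then have "0 \<le> c * G x" "c * G x \<le> F y0"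
      using c Gpos by (auto simp: c_def field_simps)
    moreover have "a < 0" "F y0 < b"
      using F_mono[of "-1" 0] F_mono[of y0 "y0 + 1"] F0 by (auto simp: a_def b_def)
    ultimately have "(S has_real_derivative exp (g (T x) + T x)) (at (c * G x))"
      unfolding T_def by (intro S_deriv) auto
    from DERIV_chain2[OF this DERIV_cmult[OF G]] show ?thesis
      by (simp add: T_def[abs_def] p_def mult_ac)
  qed
  have "\<Psi> x0 \<le> \<Psi> 0"
  proof (rule DERIV_nonpos_imp_nonincreasing[where f = \<Psi>])
    show "0 \<le> x0"
      using x0 by simp
    fix x assume x: "0 \<le> x" "x \<le> x0"
    define u where "u = (x - T x) / 2"
    define E where "E = exp (cost u - (x + T x) / 2)"
    have p_pos: "p x > 0"
      using c by (simp add: p_def)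
    have "((\<lambda>x. (x - T x) / 2) has_real_derivative (1 - p x) / 2) (at x)"
      by (intro DERIV_cdivide DERIV_diff DERIV_ident T_deriv x)
    from DERIV_chain2[OF DERIV_cost this]
    have dcost: "((\<lambda>x. cost ((x - T x) / 2)) has_real_derivative cost_slope u * ((1 - p x) / 2)) (at x)"
      by (simp add: u_def)
    have "(\<Psi> has_real_derivative
      E * (cost_slope u * ((1 - p x) / 2) - (1 + p x) / 2) + sqrt c * exp (h x - x)) (at x)"
      unfolding \<Psi>_def[abs_def] E_def u_def
      by (rule derivative_eq_intros dcost[unfolded u_def] T_deriv G x refl | simp)+
    moreover have "sqrt c * exp (h x - x) \<le> E * ((1 + p x) / 2 - cost_slope u * (1 - p x) / 2)"
    proof -
      \<comment> \<open>Mass balance: \<open>c * exp (h x - x)\<close> equals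
        \<open>p x * exp (- g (T x) - T x)\<close>. Substituting this for one of the two factors in
        the square produces \<open>h x - g (T x)\<close>, which \<open>hg\<close> controls.\<close>
      have "(sqrt c * exp (h x - x))\<^sup>2 = p x * exp (h x - g (T x) - x - T x)"
        using c by (simp add: p_def power_mult_distrib power2_eq_square flip: exp_add)
      also have "\<dots> \<le> p x * exp (cost u - x - T x)"
        using p_pos hg[of x "T x"] by (simp add: u_def)
      also have "\<dots> = (E * (sqrt (p x) * exp (- cost u / 2)))\<^sup>2"
        using p_pos
        by (simp add: E_def power_mult_distrib algebra_simps flip: exp_double exp_add)
      finally have "sqrt c * exp (h x - x) \<le> E * (sqrt (p x) * exp (- cost u / 2))"
        by (rule power2_le_imp_le) (simp add: E_def less_imp_le p_pos)
      also have "\<dots> \<le> E * ((1 + p x) / 2 - cost_slope u * (1 - p x) / 2)"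
        by (intro mult_left_mono sqrt_exp_cost_le p_pos) (simp add: E_def)
      finally show ?thesis .
    qed
    ultimately show "\<exists>y. (\<Psi> has_real_derivative y) (at x) \<and> y \<le> 0"
      by (intro exI[where x = "E * (cost_slope u * ((1 - p x) / 2) - (1 + p x) / 2) + sqrt c * exp (h x - x)"])
        (simp add: algebra_simps)
  qed
  moreover have "T 0 = 0"
    using SF[of 0] by (simp add: T_def G0 F0)
  ultimately have "exp (cost ((x0 - T x0) / 2) - (x0 + T x0) / 2) + sqrt c * G x0 \<le> 1"
    by (simp add: \<Psi>_def G0)
  then have "sqrt c * G x0 \<le> 1"
    using exp_gt_zero[of "cost ((x0 - T x0) / 2) - (x0 + T x0) / 2"] by linarith
  then have "(sqrt c * G x0)\<^sup>2 \<le> 1"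
    using c Gpos by (simp add: power_le_one)
  then show ?thesis
    using c Gpos Fpos by (simp add: c_def power_mult_distrib power2_eq_square mult_ac)
qed

subsection \<open>Exponential laws and their log-Laplace transforms\<close>

lemma nn_integral_nu_plus:
  assumes [measurable]: "f \<in> borel_measurable borel"
  shows "(\<integral>\<^sup>+ x. f x \<partial>nu_plus) = (\<integral>\<^sup>+ x. ennreal (exp (- x)) * indicator {0..} x * f x \<partial>lborel)"
  unfolding nu_plus_def
  by (subst nn_integral_density) (auto simp: ennreal_mult' simp flip: ennreal_indicator)

lemma sets_nu_plus [measurable_cong, simp]: "sets nu_plus = sets borel"
  and space_nu_plus [simp]: "space nu_plus = UNIV"
  by (simp_all add: nu_plus_def)

lemma sets_nu_sym [measurable_cong, simp]: "sets nu_sym = sets borel"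
  and space_nu_sym [simp]: "space nu_sym = UNIV"
  by (simp_all add: nu_sym_def)

lemma prob_space_nu_plus: "prob_space nu_plus"
proof
  have "emeasure nu_plus (space nu_plus) = (\<integral>\<^sup>+ x. 1 \<partial>nu_plus)"
    by simp
  also have "\<dots> = 1"
    using nn_intergal_power_times_exp_Ici[of 0] by (subst nn_integral_nu_plus) auto
  finally show "emeasure nu_plus (space nu_plus) = 1" .
qed

lemma prob_space_reflect:
  assumes "prob_space \<mu>" "sets \<mu> = sets borel"
  shows "prob_space (reflect \<mu>)" "sets (reflect \<mu>) = sets borel"
proof -
  interpret prob_space \<mu> by fact
  have [measurable_cong]: "sets \<mu> = sets borel" by fact
  show "prob_space (reflect \<mu>)"
    unfolding reflect_def by (rule prob_space_distr) measurable
qed (simp add: reflect_def)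

lemma nn_integral_symmetrize:
  assumes "prob_space \<mu>" and sets[measurable_cong]: "sets \<mu> = sets borel"
    and [measurable]: "f \<in> borel_measurable borel"
  shows "(\<integral>\<^sup>+ x. f x \<partial>symmetrize \<mu>) = (\<integral>\<^sup>+ x. \<integral>\<^sup>+ y. f (x - y) \<partial>\<mu> \<partial>\<mu>)"
proof -
  interpret prob_space \<mu> by fact
  interpret r: prob_space "reflect \<mu>"
    by (rule prob_space_reflect) fact+
  have "(\<integral>\<^sup>+ x. f x \<partial>symmetrize \<mu>) = (\<integral>\<^sup>+ x. \<integral>\<^sup>+ y. f (x + y) \<partial>reflect \<mu> \<partial>\<mu>)"
    unfolding symmetrize_def
    by (rule nn_integral_convolution)
      (auto simp: sets reflect_def intro!: finite_measure_axioms r.finite_measure_axioms[unfolded reflect_def])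
  also have "\<dots> = (\<integral>\<^sup>+ x. \<integral>\<^sup>+ y. f (x - y) \<partial>\<mu> \<partial>\<mu>)"
    by (simp add: reflect_def nn_integral_distr)
  finally show ?thesis .
qed

lemma nn_integral_exp_minus_Ici:
  assumes "c > 0"
  shows "(\<integral>\<^sup>+ x. ennreal (exp (- c * x)) * indicator {a..} x \<partial>lborel) = ennreal (exp (- c * a) / c)"
proof -
  have "(\<integral>\<^sup>+ x. ennreal (exp (- c * x)) * indicator {a..} x \<partial>lborel) = ennreal (0 - - exp (- c * a) / c)"
  proof (rule nn_integral_FTC_atLeast)
    show "((\<lambda>x. - exp (- c * x) / c) has_real_derivative exp (- c * x)) (at x)" for x
      using assms by (auto intro!: derivative_eq_intros)
    show "((\<lambda>x. - exp (- c * x) / c) \<longlongrightarrow> 0) at_top"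
      using assms by real_asymp
  qed auto
  then show ?thesis
    by simp
qed

text \<open>This reduces the cost for \<open>nu_plus\<close> to the Laplace transform of
  \<open>nu_sym\<close>, and lets \<open>nu_sym\<close> receive property (tau) from
  \<open>nu_plus\<close>.\<close>

lemma symmetrize_nu_plus: "symmetrize nu_plus = nu_sym"
proof (rule measure_eqI)
  show "sets (symmetrize nu_plus) = sets nu_sym"
    by (simp add: symmetrize_def)
  fix A assume "A \<in> sets (symmetrize nu_plus)"
  then have [measurable]: "A \<in> sets borel"
    by (simp add: symmetrize_def)
  let ?E = "\<lambda>x. ennreal (exp (- x)) * indicator {0..} x"
  let ?e = "\<lambda>x y. ennreal (exp (- x) * exp (- 2 * y)) * indicator {0..} y * indicator {0..} (x + y) * (indicator A x :: ennreal)"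
  have "emeasure (symmetrize nu_plus) A = (\<integral>\<^sup>+ x. indicator A x \<partial>symmetrize nu_plus)"
    by (simp add: symmetrize_def)
  also have "\<dots> = (\<integral>\<^sup>+ x. \<integral>\<^sup>+ y. indicator A (x - y) \<partial>nu_plus \<partial>nu_plus)"
    by (rule nn_integral_symmetrize) (auto simp: prob_space_nu_plus)
  also have "\<dots> = (\<integral>\<^sup>+ x. \<integral>\<^sup>+ y. ?E x * (?E y * indicator A (x - y)) \<partial>lborel \<partial>lborel)"
    by (simp add: nn_integral_nu_plus nn_integral_cmult)
  also have "\<dots> = (\<integral>\<^sup>+ y. \<integral>\<^sup>+ x. ?E x * (?E y * indicator A (x - y)) \<partial>lborel \<partial>lborel)"
    by (rule lborel_pair.Fubini') measurable
  also have "\<dots> = (\<integral>\<^sup>+ y. \<integral>\<^sup>+ x. ?E (y + x) * (?E y * indicator A x) \<partial>lborel \<partial>lborel)"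
  proof (rule nn_integral_cong)
    fix y :: real
    show "(\<integral>\<^sup>+ x. ?E x * (?E y * indicator A (x - y)) \<partial>lborel) = (\<integral>\<^sup>+ x. ?E (y + x) * (?E y * indicator A x) \<partial>lborel)"
      by (subst nn_integral_real_affine[where c = 1 and t = y]) auto
  qed
  also have "\<dots> = (\<integral>\<^sup>+ y. \<integral>\<^sup>+ x. ?e x y \<partial>lborel \<partial>lborel)"
    by (intro nn_integral_cong)
      (auto simp: indicator_def add.commute simp flip: ennreal_mult exp_add)
  also have "\<dots> = (\<integral>\<^sup>+ x. \<integral>\<^sup>+ y. ?e x y \<partial>lborel \<partial>lborel)"
    by (rule lborel_pair.Fubini') measurable
  also have "\<dots> = (\<integral>\<^sup>+ x. ennreal (exp (- \<bar>x\<bar>) / 2) * indicator A x \<partial>lborel)"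
  proof (rule nn_integral_cong)
    fix x :: real
    \<comment> \<open>The two constraints on \<open>y\<close> merge into
      \<open>y \<ge> max 0 (- x)\<close>, and
      \<open>- x - 2 * max 0 (- x) = - \<bar>x\<bar>\<close>.\<close>
    have "(\<integral>\<^sup>+ y. ?e x y \<partial>lborel)
      = (\<integral>\<^sup>+ y. ennreal (exp (- x)) * indicator A x * (ennreal (exp (- 2 * y)) * indicator {max 0 (- x)..} y) \<partial>lborel)"
      by (intro nn_integral_cong) (auto simp: indicator_def ennreal_mult)
    also have "\<dots> = ennreal (exp (- x)) * indicator A x * ennreal (exp (- 2 * max 0 (- x)) / 2)"
      by (subst nn_integral_cmult) (auto simp: nn_integral_exp_minus_Ici[of 2, simplified])
    also have "\<dots> = ennreal (exp (- x) * exp (- 2 * max 0 (- x)) / 2) * indicator A x"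
      by (simp add: mult_ac flip: ennreal_mult)
    also have "exp (- x) * exp (- 2 * max 0 (- x)) = exp (- \<bar>x\<bar>)"
      by (auto simp: max_def simp flip: exp_add)
    finally show "(\<integral>\<^sup>+ y. ?e x y \<partial>lborel) = ennreal (exp (- \<bar>x\<bar>) / 2) * indicator A x" .
  qed
  also have "\<dots> = emeasure nu_sym A"
    by (simp add: nu_sym_def emeasure_density)
  finally show "emeasure (symmetrize nu_plus) A = emeasure nu_sym A" .
qed

section \<open>Laplace and Legendre transforms\<close>

lemma prob_space_symmetrize:
  assumes "prob_space \<mu>" "sets \<mu> = sets borel"
  shows "prob_space (symmetrize \<mu>)"
proof
  interpret prob_space \<mu> by fact
  have "emeasure (symmetrize \<mu>) (space (symmetrize \<mu>)) = (\<integral>\<^sup>+ x. 1 \<partial>symmetrize \<mu>)"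
    by simp
  also have "\<dots> = 1"
    using assms by (subst nn_integral_symmetrize) (auto simp: emeasure_space_1)
  finally show "emeasure (symmetrize \<mu>) (space (symmetrize \<mu>)) = 1" .
qed

lemma emeasure_lborel_Ici: "emeasure lborel {a::real..} = \<infinity>"
proof (rule ccontr)
  assume "emeasure lborel {a..} \<noteq> \<infinity>"
  then obtain n :: nat where "emeasure lborel {a..} < of_nat n"
    using ennreal_Ex_less_of_nat[of "emeasure lborel {a..}"] by (auto simp: less_top)
  moreover have "emeasure lborel {a..a + n} \<le> emeasure lborel {a..}"
    by (intro emeasure_mono) auto
  ultimately show False
    by (simp add: ennreal_of_nat_eq_real_of_nat)
qed

lemma laplace_nu_plus:
  "(\<integral>\<^sup>+ x. ennreal (exp (x * y)) \<partial>nu_plus) = (if y < 1 then ennreal (1 / (1 - y)) else \<infinity>)"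
proof -
  have eq: "(\<integral>\<^sup>+ x. ennreal (exp (x * y)) \<partial>nu_plus)
      = (\<integral>\<^sup>+ x. ennreal (exp (- (1 - y) * x)) * indicator {0..} x \<partial>lborel)"
    by (subst nn_integral_nu_plus, measurable, intro nn_integral_cong)
      (auto simp: indicator_def algebra_simps simp flip: ennreal_mult exp_add)
  show ?thesis
  proof (cases "y < 1")
    case True
    then show ?thesis
      unfolding eq using nn_integral_exp_minus_Ici[of "1 - y" 0] by simp
  next
    case False
    have "\<infinity> = (\<integral>\<^sup>+ x. indicator {0::real..} x \<partial>lborel)"
      by (simp add: emeasure_lborel_Ici)
    also have "\<dots> \<le> (\<integral>\<^sup>+ x. ennreal (exp (- (1 - y) * x)) * indicator {0..} x \<partial>lborel)"
      using False
      by (intro nn_integral_mono) (auto simp: indicator_def mult_nonpos_nonneg)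
    finally show ?thesis
      unfolding eq using False by (simp add: top_unique)
  qed
qed

lemma laplace_symmetrize:
  assumes "prob_space \<mu>" and sets[measurable_cong]: "sets \<mu> = sets borel"
  shows "(\<integral>\<^sup>+ x. ennreal (exp (x * y)) \<partial>symmetrize \<mu>)
    = (\<integral>\<^sup>+ x. ennreal (exp (x * y)) \<partial>\<mu>) * (\<integral>\<^sup>+ x. ennreal (exp (x * - y)) \<partial>\<mu>)"
proof -
  have "(\<integral>\<^sup>+ x. ennreal (exp (x * y)) \<partial>symmetrize \<mu>)
      = (\<integral>\<^sup>+ x. \<integral>\<^sup>+ z. ennreal (exp (x * y)) * ennreal (exp (z * - y)) \<partial>\<mu> \<partial>\<mu>)"
    using assms
    by (subst nn_integral_symmetrize) (auto simp: algebra_simps simp flip: ennreal_mult exp_add)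
  then show ?thesis
    by (simp add: nn_integral_cmult nn_integral_multc)
qed

text \<open>The transform is a product over two independent variables. For
  \<open>\<bar>y\<bar> \<ge> 1\<close> exactly one factor is infinite and the other is positive, so
  \<open>0 * \<infinity>\<close> never occurs.\<close>

lemma laplace_nu_sym:
  "(\<integral>\<^sup>+ x. ennreal (exp (x * y)) \<partial>nu_sym) = (if \<bar>y\<bar> < 1 then ennreal (1 / (1 - y\<^sup>2)) else \<infinity>)"
proof -
  have "(1 - y) * (1 + y) = 1 - y\<^sup>2"
    by (simp add: power2_eq_square algebra_simps)
  then show ?thesis
    unfolding symmetrize_nu_plus[symmetric] laplace_symmetrize[OF prob_space_nu_plus sets_nu_plus] laplace_nu_plus
    by (auto simp: ennreal_mult_top ennreal_top_mult simp flip: ennreal_mult)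
qed

lemma log_laplace_nu_sym:
  "log_laplace nu_sym y = (if \<bar>y\<bar> < 1 then ereal (- ln (1 - y\<^sup>2)) else \<infinity>)"
  using abs_square_less_1[of y] by (auto simp: log_laplace_def laplace_nu_sym Let_def ln_div)

lemma log_laplace_symmetrize_nu_sym:
  "log_laplace (symmetrize nu_sym) y = (if \<bar>y\<bar> < 1 then ereal (- 2 * ln (1 - y\<^sup>2)) else \<infinity>)"
proof -
  have "prob_space nu_sym"
    using prob_space_symmetrize[OF prob_space_nu_plus] by (simp add: symmetrize_nu_plus)
  then have "(\<integral>\<^sup>+ x. ennreal (exp (x * y)) \<partial>symmetrize nu_sym)
      = (if \<bar>y\<bar> < 1 then ennreal (1 / (1 - y\<^sup>2) * (1 / (1 - y\<^sup>2))) else \<infinity>)"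
    using abs_square_less_1[of y]
    unfolding laplace_symmetrize[OF \<open>prob_space nu_sym\<close> sets_nu_sym] laplace_nu_sym
    by (auto simp flip: ennreal_mult)
  then show ?thesis
    using abs_square_less_1[of y] by (auto simp: log_laplace_def Let_def ln_div ln_mult)
qed

text \<open>Taking out the factor \<open>c\<close> leaves the supremum of
  \<open>u / c * y + ln (1 - y\<^sup>2)\<close>. The case \<open>c = 1\<close> serves
  \<open>nu_sym\<close> and \<open>c = 2\<close> its symmetrisation.\<close>

lemma legendre_eq_cost:
  assumes c: "c > 0"
    and L: "\<And>y. log_laplace \<mu> y = (if \<bar>y\<bar> < 1 then ereal (- c * ln (1 - y\<^sup>2)) else \<infinity>)"
  shows "legendre \<mu> u = ereal (c * cost (u / c))"
  unfolding legendre_def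
proof (rule SUP_eqI)
  fix y
  show "ereal (u * y) - log_laplace \<mu> y \<le> ereal (c * cost (u / c))"
  proof (cases "\<bar>y\<bar> < 1")
    case True
    from mult_left_mono[OF cost_ge[OF this, of "u / c"], of c] show ?thesis
      using c True by (simp add: L algebra_simps)
  qed (simp add: L)
next
  fix z
  assume "\<And>y. y \<in> UNIV \<Longrightarrow> ereal (u * y) - log_laplace \<mu> y \<le> z"
  from this[of "cost_slope (u / c)"] show "ereal (c * cost (u / c)) \<le> z"
    using c abs_cost_slope_less[of "u / c"] cost_eq_at_slope[of "u / c"]
    by (simp add: L algebra_simps)
qed

subsection \<open>Infimum convolutions and property (tau)\<close>

text \<open>A real \<open>INF\<close> is meaningful only for families bounded below; hence the
  recurring lower bounds on \<open>w\<close> and \<open>f\<close>.\<close>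

definition rinf_conv :: "(real \<Rightarrow> real) \<Rightarrow> (real \<Rightarrow> real) \<Rightarrow> real \<Rightarrow> real" where
  "rinf_conv w f x = (INF y. w (x - y) + f y)"

lemma rinf_conv_le:
  assumes "\<And>u. 0 \<le> w u" "\<And>y. m \<le> f y"
  shows "rinf_conv w f x \<le> w (x - y) + f y"
  unfolding rinf_conv_def
proof (rule cINF_lower)
  show "bdd_below (range (\<lambda>y. w (x - y) + f y))"
    using assms by (intro bdd_belowI2[where m = m]) (smt (verit))
qed simp

lemma rinf_conv_greatest: "(\<And>y. a \<le> w (x - y) + f y) \<Longrightarrow> a \<le> rinf_conv w f x"
  unfolding rinf_conv_def by (rule cINF_greatest) auto

lemma inf_conv_eq_rinf_conv:
  assumes "\<And>u. 0 \<le> w u" "\<And>y. m \<le> f y"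
  shows "inf_conv (\<lambda>x. ereal (w x)) f x = ereal (rinf_conv w f x)"
  unfolding inf_conv_def
proof (rule INF_eqI)
  fix y
  show "ereal (rinf_conv w f x) \<le> ereal (w (x - y)) + ereal (f y)"
    using rinf_conv_le[of w m f x y] assms by simp
next
  fix z assume z: "\<And>y. y \<in> UNIV \<Longrightarrow> z \<le> ereal (w (x - y)) + ereal (f y)"
  show "z \<le> ereal (rinf_conv w f x)"
  proof (cases z)
    case (real r)
    then show ?thesis
      using z by (auto intro!: rinf_conv_greatest)
  qed (use z[of 0] in auto)
qed

text \<open>An infimum of vertically shifted translates of \<open>w\<close> keeps the Lipschitz
  constant of \<open>w\<close>, however irregular \<open>f\<close> is.\<close>

lemma rinf_conv_lipschitz:
  assumes "\<And>u. 0 \<le> w u" "\<And>y. m \<le> f y" and w: "1-lipschitz_on UNIV w"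
  shows "1-lipschitz_on UNIV (rinf_conv w f)"
proof -
  have le: "rinf_conv w f x \<le> rinf_conv w f x' + \<bar>x - x'\<bar>" for x x'
  proof -
    have "rinf_conv w f x - \<bar>x - x'\<bar> \<le> w (x' - y) + f y" for y
      using rinf_conv_le[of w m f x y] lipschitz_onD[OF w, of "x - y" "x' - y"] assms(1,2)
      by (simp add: dist_real_def)
    then have "rinf_conv w f x - \<bar>x - x'\<bar> \<le> rinf_conv w f x'"
      by (rule rinf_conv_greatest)
    then show ?thesis
      by simp
  qed
  show ?thesis
  proof (rule lipschitz_onI)
    show "dist (rinf_conv w f x) (rinf_conv w f x') \<le> 1 * dist x x'" for x x'
      using le[of x x'] le[of x' x] by (auto simp: dist_real_def)
  qed simp
qed

lemma lipschitz_on_UNIV_borel: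
  fixes f :: "real \<Rightarrow> real"
  assumes "L-lipschitz_on UNIV f"
  shows "f \<in> borel_measurable borel"
  using assms by (intro borel_measurable_continuous_onI lipschitz_on_continuous_on)

lemma cost_scaled_lipschitz:
  assumes "0 \<le> c" "0 < d" "c \<le> d"
  shows "1-lipschitz_on UNIV (\<lambda>x. c * cost (x / d))"
proof (rule lipschitz_onI)
  fix x y :: real
  have "\<bar>cost (x / d) - cost (y / d)\<bar> \<le> \<bar>x / d - y / d\<bar>"
    using cost_lipschitz[of "x / d" "y / d"] cost_lipschitz[of "y / d" "x / d"] by linarith
  then have "c * \<bar>cost (x / d) - cost (y / d)\<bar> \<le> c * (\<bar>x - y\<bar> / d)"
    using assms by (intro mult_left_mono) (simp_all flip: diff_divide_distrib)
  also have "\<dots> \<le> \<bar>x - y\<bar>"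
    using assms mult_right_mono[of c d "\<bar>x - y\<bar>"] by (simp add: field_simps)
  finally show "dist (c * cost (x / d)) (c * cost (y / d)) \<le> 1 * dist x y"
    using assms by (simp add: dist_real_def abs_mult flip: right_diff_distrib)
qed simp

section \<open>Property (tau) for the one-sided law and for symmetrisations\<close>

lemma property_tau_real_iff:
  assumes "\<And>u. 0 \<le> w u"
  shows "property_tau \<mu> (\<lambda>x. ereal (w x)) \<longleftrightarrow>
    (\<forall>f. f \<in> borel_measurable borel \<longrightarrow> bounded (range f) \<longrightarrow>
      (\<integral>\<^sup>+ x. ennreal (exp (rinf_conv w f x)) \<partial>\<mu>) * (\<integral>\<^sup>+ x. ennreal (exp (- f x)) \<partial>\<mu>) \<le> 1)"
proof -
  have "eexp (inf_conv (\<lambda>x. ereal (w x)) f x) = ennreal (exp (rinf_conv w f x))"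
    if bdd: "bounded (range f)" for f x
  proof -
    from bdd obtain M where "\<And>y. \<bar>f y\<bar> \<le> M"
      unfolding bounded_iff by auto
    then have "\<And>y. - M \<le> f y"
      using abs_le_D2 by (metis minus_le_iff)
    from inf_conv_eq_rinf_conv[OF assms this] show ?thesis
      by (simp add: eexp_def)
  qed
  then show ?thesis
    unfolding property_tau_def by (auto cong: imp_cong)
qed

text \<open>The half-line is exhausted by \<open>[0, n]\<close>, since
  \<open>transport_bound\<close> speaks about finite endpoints.\<close>

lemma nn_integral_nu_plus_SUP:
  assumes G: "\<And>x. (G has_real_derivative exp (h x - x)) (at x)" and "G 0 = 0"
    and [measurable]: "h \<in> borel_measurable borel"
  shows "(\<integral>\<^sup>+ x. ennreal (exp (h x)) \<partial>nu_plus) = (SUP n. ennreal (G (real n)))"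
proof -
  let ?f = "\<lambda>(n::nat) x. ennreal (exp (h x - x)) * indicator {0..real n} x"
  have "(\<integral>\<^sup>+ x. ennreal (exp (h x)) \<partial>nu_plus) = (\<integral>\<^sup>+ x. (SUP n. ?f n x) \<partial>lborel)"
  proof (subst nn_integral_nu_plus, measurable, rule nn_integral_cong)
    fix x :: real
    obtain N :: nat where N: "x \<le> real N"
      using real_arch_simple by blast
    have "(SUP n. ?f n x) = ennreal (exp (h x - x)) * indicator {0..} x"
    proof (rule SUP_eqI)
      show "?f n x \<le> ennreal (exp (h x - x)) * indicator {0..} x" for n
        by (intro mult_left_mono) (auto simp: indicator_def)
      show "ennreal (exp (h x - x)) * indicator {0..} x \<le> z" if "\<And>n. n \<in> UNIV \<Longrightarrow> ?f n x \<le> z" for z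
        using that[of N] N by (auto simp: indicator_def)
    qed
    then show "ennreal (exp (- x)) * indicator {0..} x * ennreal (exp (h x)) = (SUP n. ?f n x)"
      by (auto simp: indicator_def simp flip: ennreal_mult exp_add)
  qed
  also have "\<dots> = (SUP n. \<integral>\<^sup>+ x. ?f n x \<partial>lborel)"
    by (rule nn_integral_monotone_convergence_SUP)
      (auto simp: incseq_def le_fun_def indicator_def)
  also have "\<dots> = (SUP n. ennreal (G (real n)))"
  proof (rule SUP_cong)
    show "(\<integral>\<^sup>+ x. ?f n x \<partial>lborel) = ennreal (G (real n))" for n
      using nn_integral_FTC_Icc[of "\<lambda>x. exp (h x - x)" 0 "real n" G] G \<open>G 0 = 0\<close>
      by (auto intro: has_field_derivative_at_within)
  qed simp
  finally show ?thesis .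
qed

text \<open>Normalised at \<open>0\<close> but differentiable on the whole line:
  \<open>transport_bound\<close> differentiates at \<open>0\<close> from both sides and evaluates
  \<open>F\<close> at \<open>-1\<close>.\<close>

lemma ex_antiderivative:
  fixes f :: "real \<Rightarrow> real"
  assumes "continuous_on UNIV f"
  shows "\<exists>F. (\<forall>x. (F has_real_derivative f x) (at x)) \<and> F 0 = 0"
proof -
  obtain F where "\<And>x. (F has_vector_derivative f x) (at x)"
    using einterval_antiderivative[of "-\<infinity>" "\<infinity>" f] assms
    by (auto simp: continuous_on_eq_continuous_at)
  then have "((\<lambda>x. F x - F 0) has_real_derivative f x) (at x)" for x
    by (auto intro!: derivative_eq_intros simp: has_real_derivative_iff_has_vector_derivative)
  then show ?thesis
    by (intro exI[of _ "\<lambda>x. F x - F 0"]) auto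
qed

lemma SUP_mult_SUP_le_ennreal:
  fixes a b :: "'i \<Rightarrow> ennreal"
  assumes "\<And>i j. a i * b j \<le> c"
  shows "(SUP i. a i) * (SUP j. b j) \<le> c"
  unfolding SUP_mult_right_ennreal unfolding SUP_mult_left_ennreal
  using assms by (intro SUP_least) auto

lemma property_tau_nu_plus: "property_tau nu_plus (\<lambda>x. ereal (cost (x / 2)))"
proof (subst property_tau_real_iff[OF cost_nonneg], intro allI impI)
  fix f :: "real \<Rightarrow> real"
  assume [measurable]: "f \<in> borel_measurable borel" and "bounded (range f)"
  then obtain M where M: "\<And>y. \<bar>f y\<bar> \<le> M"
    unfolding bounded_iff by auto
  define w where "w x = cost (x / 2)" for x
  have w: "0 \<le> w x" "w (- x) = w x" "w 0 = 0" for x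
    using cost_minus[of "x / 2"] by (simp_all add: w_def cost_nonneg)
  have w_lip: "1-lipschitz_on UNIV w"
    unfolding w_def using cost_scaled_lipschitz[of 1 2] by simp
  have f_ge: "- M \<le> f y" for y
    using M[of y] by linarith
  define h where "h = rinf_conv w f"
  have h_lip: "1-lipschitz_on UNIV h"
    unfolding h_def by (rule rinf_conv_lipschitz) (fact w f_ge w_lip)+
  have h_le: "h x \<le> w (x - y) + f y" for x y
    unfolding h_def by (rule rinf_conv_le) (fact w f_ge)+
  \<comment> \<open>The lower bound makes the infimum convolution of \<open>w\<close> and
    \<open>- h\<close> below a genuine infimum.\<close>
  have h_le_M: "- M \<le> - h x" for x
    using h_le[of x x] M[of x] by (simp add: w)
  \<comment> \<open>\<open>g\<close> is the least function satisfying \<open>h x \<le> w (x - y) + g y\<close>. It improves on \<open>f\<close>,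
    and unlike \<open>f\<close> it is continuous, so the densities have genuine antiderivatives.\<close>
  define g where "g y = - rinf_conv w (\<lambda>x. - h x) y" for y
  have g_lip: "1-lipschitz_on UNIV g"
    unfolding g_def by (intro lipschitz_on_minus rinf_conv_lipschitz) (fact w h_le_M w_lip)+
  have g_le: "g y \<le> f y" for y
  proof -
    have "- f y \<le> w (y - x) + - h x" for x
      using h_le[of x y] w(2)[of "x - y"] by simp
    then have "- f y \<le> rinf_conv w (\<lambda>x. - h x) y"
      by (rule rinf_conv_greatest)
    then show ?thesis
      by (simp add: g_def)
  qed
  have hg: "h x - g y \<le> cost ((x - y) / 2)" for x y
    using rinf_conv_le[of w "- M" "\<lambda>x. - h x" y x] w(1) h_le_M w(2)[of "x - y"]
    by (simp add: g_def w_def)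
  have [measurable]: "h \<in> borel_measurable borel" "g \<in> borel_measurable borel"
    using h_lip g_lip by (auto intro: lipschitz_on_UNIV_borel)
  obtain G where G: "\<And>x. (G has_real_derivative exp (h x - x)) (at x)" "G 0 = 0"
    using ex_antiderivative[of "\<lambda>x. exp (h x - x)"] lipschitz_on_continuous_on[OF h_lip]
    by (force intro: continuous_intros)
  obtain F where F: "\<And>x. (F has_real_derivative exp (- g x - x)) (at x)" "F 0 = 0"
    using ex_antiderivative[of "\<lambda>x. exp (- g x - x)"] lipschitz_on_continuous_on[OF g_lip]
    by (force intro: continuous_intros)
  have GF: "G (real n) * F (real m) \<le> 1" for n m
    using transport_bound[OF G F hg, of "real n" "real m"] G(2) F(2)
    by (cases "n = 0 \<or> m = 0") auto
  \<comment> \<open>\<open>ennreal\<close> sends negative numbers to \<open>0\<close>; the sign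
    allows the product of two \<open>ennreal\<close> values to become one.\<close>
  have F_nonneg: "0 \<le> F (real n)" for n
    using DERIV_nonneg_imp_nondecreasing[of 0 "real n" F] F by fastforce
  have "(\<integral>\<^sup>+ x. ennreal (exp (h x)) \<partial>nu_plus) * (\<integral>\<^sup>+ x. ennreal (exp (- f x)) \<partial>nu_plus)
      \<le> (\<integral>\<^sup>+ x. ennreal (exp (h x)) \<partial>nu_plus) * (\<integral>\<^sup>+ x. ennreal (exp (- g x)) \<partial>nu_plus)"
    using g_le by (intro mult_left_mono nn_integral_mono) auto
  also have "\<dots> = (SUP n. ennreal (G (real n))) * (SUP n. ennreal (F (real n)))"
    by (simp add: nn_integral_nu_plus_SUP[OF G] nn_integral_nu_plus_SUP[OF F])
  also have "\<dots> \<le> 1"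
    using GF F_nonneg by (intro SUP_mult_SUP_le_ennreal) (simp add: ennreal_le_1 flip: ennreal_mult'')
  finally show "(\<integral>\<^sup>+ x. ennreal (exp (rinf_conv (\<lambda>x. cost (x / 2)) f x)) \<partial>nu_plus)
      * (\<integral>\<^sup>+ x. ennreal (exp (- f x)) \<partial>nu_plus) \<le> 1"
    by (simp add: h_def w_def[abs_def])
qed

text \<open>Property (tau) is applied to one variable at a time. With the second variable fixed at
  \<open>y\<close>, the first gives the bound \<open>exp (w (y - t) + \<phi> t)\<close> for every
  \<open>t\<close>. The infimum over \<open>t\<close> is the infimum convolution of \<open>w\<close>
  and \<open>\<phi>\<close>, ready for the second variable.\<close>

lemma property_tau_symmetrize:
  assumes \<mu>: "prob_space \<mu>" and sets[measurable_cong, simp]: "sets \<mu> = sets borel"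
    and w: "\<And>u. 0 \<le> w u" "\<And>u. w (- u) = w u" "1-lipschitz_on UNIV w"
    and v: "\<And>u. 0 \<le> v u" "1-lipschitz_on UNIV v"
    and vw: "\<And>a b. v (a + b) \<le> w a + w b"
    and tau: "property_tau \<mu> (\<lambda>x. ereal (w x))"
  shows "property_tau (symmetrize \<mu>) (\<lambda>x. ereal (v x))"
proof (subst property_tau_real_iff[OF v(1)], intro allI impI)
  interpret prob_space \<mu> by (rule \<mu>)
  have space[simp]: "space \<mu> = UNIV"
    using sets_eq_imp_space_eq[OF sets] by simp
  fix f :: "real \<Rightarrow> real"
  assume [measurable]: "f \<in> borel_measurable borel" and "bounded (range f)"
  then obtain M where M: "\<And>y. \<bar>f y\<bar> \<le> M"
    unfolding bounded_iff by auto
  have f_ge: "- M \<le> f y" and f_le: "f y \<le> M" for y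
    using M[of y] by linarith+
  have tau': "(\<integral>\<^sup>+ x. ennreal (exp (rinf_conv w k x)) \<partial>\<mu>) * (\<integral>\<^sup>+ x. ennreal (exp (- k x)) \<partial>\<mu>) \<le> 1"
    if "k \<in> borel_measurable borel" "bounded (range k)" for k
    using tau that property_tau_real_iff[of w \<mu>] w(1) by blast
  define H where "H = rinf_conv v f"
  have [measurable]: "H \<in> borel_measurable borel"
    unfolding H_def using rinf_conv_lipschitz[OF v(1) f_ge v(2)] by (rule lipschitz_on_UNIV_borel)
  \<comment> \<open>\<open>I\<close> integrates out the first variable and \<open>\<phi>\<close> is
    built so that \<open>exp (- \<phi> t)\<close> is \<open>I t\<close>. Since \<open>f\<close> is
    bounded, \<open>I\<close> stays between two positive constants: \<open>enn2real\<close> and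
    \<open>ln\<close> lose nothing, and \<open>\<phi>\<close> is bounded as \<open>tau'\<close>
    requires.\<close>
  define I where "I t = (\<integral>\<^sup>+ s. ennreal (exp (- f (s - t))) \<partial>\<mu>)" for t
  define \<phi> where "\<phi> t = - ln (enn2real (I t))" for t
  have I_bounds: "ennreal (exp (- M)) \<le> I t" "I t \<le> ennreal (exp M)" for t
  proof -
    have "(\<integral>\<^sup>+ s. ennreal (exp (- M)) \<partial>\<mu>) \<le> I t"
      unfolding I_def using f_le by (intro nn_integral_mono) auto
    then show "ennreal (exp (- M)) \<le> I t"
      using emeasure_space_1 by simp
    have "I t \<le> (\<integral>\<^sup>+ s. ennreal (exp M) \<partial>\<mu>)"
      unfolding I_def using f_ge by (intro nn_integral_mono) (auto simp: minus_le_iff)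
    then show "I t \<le> ennreal (exp M)"
      using emeasure_space_1 by simp
  qed
  have I_fin: "I t < top" for t
    using I_bounds(2)[of t] by (rule le_less_trans) simp
  have I_real: "exp (- M) \<le> enn2real (I t)" "enn2real (I t) \<le> exp M" for t
    using enn2real_mono[OF I_bounds(1)[of t] I_fin] enn2real_mono[OF I_bounds(2)[of t]] by auto
  have I_pos: "0 < enn2real (I t)" for t
    using I_real(1)[of t] exp_gt_zero[of "- M"] by linarith
  have I_eq: "I t = ennreal (exp (- \<phi> t))" for t
    using I_pos[of t] I_fin[of t] by (simp add: \<phi>_def)
  have \<phi>_bound: "\<bar>\<phi> t\<bar> \<le> M" for t
  proof -
    have "ln (exp (- M)) \<le> ln (enn2real (I t))" "ln (enn2real (I t)) \<le> ln (exp M)"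
      using I_real[of t] I_pos[of t] by (intro ln_mono; simp)+
    then show ?thesis
      by (simp add: \<phi>_def abs_le_iff)
  qed
  have I_meas[measurable]: "I \<in> borel_measurable borel"
    unfolding I_def by measurable
  have \<phi>_meas[measurable]: "\<phi> \<in> borel_measurable borel"
    unfolding \<phi>_def by measurable
  have \<phi>_bdd: "bounded (range \<phi>)"
    unfolding bounded_iff using \<phi>_bound by auto
  have H_le: "(\<integral>\<^sup>+ x. ennreal (exp (H (x - y))) \<partial>\<mu>) \<le> ennreal (exp (w (y - t) + \<phi> t))" for y t
  proof -
    define g where "g = rinf_conv w (\<lambda>s. f (s - t))"
    have [measurable]: "g \<in> borel_measurable borel"
      unfolding g_def using rinf_conv_lipschitz[OF w(1) f_ge w(3)] by (rule lipschitz_on_UNIV_borel)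
    have "(\<integral>\<^sup>+ x. ennreal (exp (g x)) \<partial>\<mu>) * I t \<le> 1"
      unfolding g_def I_def
    proof (rule tau')
      show "bounded (range (\<lambda>s. f (s - t)))"
        unfolding bounded_iff using M by auto
    qed measurable
    then have "(\<integral>\<^sup>+ x. ennreal (exp (g x)) \<partial>\<mu>) * I t * ennreal (exp (\<phi> t)) \<le> ennreal (exp (\<phi> t))"
      using mult_right_mono by fastforce
    moreover have "I t * ennreal (exp (\<phi> t)) = 1"
      by (simp add: I_eq flip: ennreal_mult exp_add)
    ultimately have g: "(\<integral>\<^sup>+ x. ennreal (exp (g x)) \<partial>\<mu>) \<le> ennreal (exp (\<phi> t))"
      by (simp add: mult.assoc)
    have "H (x - y) \<le> w (y - t) + g x" for x
    proof -
      have "H (x - y) - w (y - t) \<le> w (x - s) + f (s - t)" for s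
      proof -
        \<comment> \<open>Candidate point \<open>s - t\<close>, because
          \<open>x - y - (s - t) = (x - s) + (t - y)\<close>. Evenness of \<open>w\<close> then
          absorbs the minus sign of the second variable.\<close>
        have "H (x - y) \<le> v (x - y - (s - t)) + f (s - t)"
          unfolding H_def by (rule rinf_conv_le) (fact v f_ge)+
        also have "v (x - y - (s - t)) \<le> w (x - s) + w (t - y)"
          using vw[of "x - s" "t - y"] by (simp add: algebra_simps)
        also have "w (t - y) = w (y - t)"
          using w(2)[of "t - y"] by simp
        finally show ?thesis
          by simp
      qed
      then have "H (x - y) - w (y - t) \<le> g x"
        unfolding g_def by (rule rinf_conv_greatest)
      then show ?thesis
        by simp
    qed
    then have "(\<integral>\<^sup>+ x. ennreal (exp (H (x - y))) \<partial>\<mu>)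
        \<le> (\<integral>\<^sup>+ x. ennreal (exp (w (y - t))) * ennreal (exp (g x)) \<partial>\<mu>)"
      by (intro nn_integral_mono) (simp flip: ennreal_mult exp_add)
    also have "\<dots> = ennreal (exp (w (y - t))) * (\<integral>\<^sup>+ x. ennreal (exp (g x)) \<partial>\<mu>)"
      by (rule nn_integral_cmult) measurable
    also have "\<dots> \<le> ennreal (exp (w (y - t))) * ennreal (exp (\<phi> t))"
      using g by (intro mult_left_mono) auto
    also have "\<dots> = ennreal (exp (w (y - t) + \<phi> t))"
      by (simp add: exp_add flip: ennreal_mult)
    finally show ?thesis .
  qed
  have H_le': "(\<integral>\<^sup>+ x. ennreal (exp (H (x - y))) \<partial>\<mu>) \<le> ennreal (exp (rinf_conv w \<phi> y))" for y
  proof -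
    define J where "J = (\<integral>\<^sup>+ x. ennreal (exp (H (x - y))) \<partial>\<mu>)"
    have J_fin: "J < top"
      using H_le[of y 0] unfolding J_def by (rule le_less_trans) simp
    show ?thesis
    \<comment> \<open>The infimum over \<open>t\<close> is taken after a logarithm; for
      \<open>J = 0\<close> the logarithm says nothing and the bound is trivial.\<close>
    proof (cases "enn2real J > 0")
      case True
      have "ln (enn2real J) \<le> w (y - t) + \<phi> t" for t
      proof -
        have "enn2real J \<le> exp (w (y - t) + \<phi> t)"
          using enn2real_mono[OF H_le[of y t]] by (simp add: J_def)
        from ln_mono[OF this True] show ?thesis
          by simp
      qed
      then have "ln (enn2real J) \<le> rinf_conv w \<phi> y"
        by (rule rinf_conv_greatest)
      then have "enn2real J \<le> exp (rinf_conv w \<phi> y)"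
        using True by (metis exp_le_cancel_iff exp_ln)
      then show ?thesis
        using J_fin unfolding J_def[symmetric] by (metis ennreal_enn2real ennreal_leI)
    next
      case False
      then show ?thesis
        using J_fin unfolding J_def[symmetric]
        by (metis ennreal_enn2real ennreal_neg linorder_not_less zero_le)
    qed
  qed
  have "(\<integral>\<^sup>+ x. ennreal (exp (H x)) \<partial>symmetrize \<mu>) = (\<integral>\<^sup>+ x. \<integral>\<^sup>+ y. ennreal (exp (H (x - y))) \<partial>\<mu> \<partial>\<mu>)"
    by (rule nn_integral_symmetrize) (auto simp: \<mu>)
  \<comment> \<open>The order is exchanged so that the inner integral runs over the first variable,
    as in \<open>H_le'\<close>.\<close>
  also have "\<dots> = (\<integral>\<^sup>+ y. \<integral>\<^sup>+ x. ennreal (exp (H (x - y))) \<partial>\<mu> \<partial>\<mu>)"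
    by (rule pair_sigma_finite.Fubini') (auto intro!: pair_sigma_finite.intro sigma_finite_measure_axioms)
  also have "\<dots> \<le> (\<integral>\<^sup>+ y. ennreal (exp (rinf_conv w \<phi> y)) \<partial>\<mu>)"
    using H_le' by (intro nn_integral_mono) auto
  finally have 1: "(\<integral>\<^sup>+ x. ennreal (exp (H x)) \<partial>symmetrize \<mu>) \<le> (\<integral>\<^sup>+ y. ennreal (exp (rinf_conv w \<phi> y)) \<partial>\<mu>)" .
  have "(\<integral>\<^sup>+ x. ennreal (exp (- f x)) \<partial>symmetrize \<mu>) = (\<integral>\<^sup>+ x. \<integral>\<^sup>+ y. ennreal (exp (- f (x - y))) \<partial>\<mu> \<partial>\<mu>)"
    by (rule nn_integral_symmetrize) (auto simp: \<mu>)
  also have "\<dots> = (\<integral>\<^sup>+ y. \<integral>\<^sup>+ x. ennreal (exp (- f (x - y))) \<partial>\<mu> \<partial>\<mu>)"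
    by (rule pair_sigma_finite.Fubini') (auto intro!: pair_sigma_finite.intro sigma_finite_measure_axioms)
  also have "\<dots> = (\<integral>\<^sup>+ t. ennreal (exp (- \<phi> t)) \<partial>\<mu>)"
    by (simp add: I_eq flip: I_def)
  finally have 2: "(\<integral>\<^sup>+ x. ennreal (exp (- f x)) \<partial>symmetrize \<mu>) = (\<integral>\<^sup>+ t. ennreal (exp (- \<phi> t)) \<partial>\<mu>)" .
  show "(\<integral>\<^sup>+ x. ennreal (exp (rinf_conv v f x)) \<partial>symmetrize \<mu>) * (\<integral>\<^sup>+ x. ennreal (exp (- f x)) \<partial>symmetrize \<mu>) \<le> 1"
    unfolding H_def[symmetric] 2
    using mult_right_mono[OF 1] tau'[OF \<phi>_meas \<phi>_bdd] by (rule order_trans) simp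
qed

theorem theorem2:
  shows "IC 2 nu_plus \<and> IC 2 nu_sym"
proof
  have W: "legendre (symmetrize nu_plus) x = ereal (cost x)" for x
    using legendre_eq_cost[of 1 nu_sym x] by (simp add: symmetrize_nu_plus log_laplace_nu_sym)
  show "IC 2 nu_plus"
    unfolding IC_def W by (rule property_tau_nu_plus)
  \<comment> \<open>One halving of \<open>x\<close> is the scale in \<open>IC 2\<close>; the other
    comes from \<open>c = 2\<close>.\<close>
  have W': "legendre (symmetrize nu_sym) (x / 2) = ereal (2 * cost (x / 4))" for x
    using legendre_eq_cost[of 2 "symmetrize nu_sym" "x / 2"] by (simp add: log_laplace_symmetrize_nu_sym)
  have "property_tau (symmetrize nu_plus) (\<lambda>x. ereal (2 * cost (x / 4)))"
  proof (rule property_tau_symmetrize[OF prob_space_nu_plus sets_nu_plus _ _ _ _ _ _ property_tau_nu_plus])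
    show "1-lipschitz_on UNIV (\<lambda>x. 2 * cost (x / 4))"
      by (rule cost_scaled_lipschitz) auto
    show "1-lipschitz_on UNIV (\<lambda>x. cost (x / 2))"
      using cost_scaled_lipschitz[of 1 2] by simp
    show "2 * cost ((a + b) / 4) \<le> cost (a / 2) + cost (b / 2)" for a b
      using cost_midpoint[of "a / 2" "b / 2"] by (simp add: add_divide_distrib)
    show "cost (- u / 2) = cost (u / 2)" for u
      using cost_minus[of "u / 2"] by simp
  qed (auto simp: cost_nonneg)
  then show "IC 2 nu_sym"
    by (simp add: IC_def W' symmetrize_nu_plus)
qed

end
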